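(* Let $\{Z_n\}_{n\ge 0}$ be a branching process in an i.i.d. random environment, with $X=\ln m_0$, $\mu=\mathbb{E}X$, $\sigma^2=\mathbb{E}(X-\mu)^2$ as in the context, such that almost surely every individual has at least one child and $0<\sigma^2<\infty$. Assume that there exists a positive constant $H$ such that $X\le\mu+H$. Let $n_0\ge0$ and $n\ge1$ be integers and write $$Z_{n_0,n}=\frac{\ln\frac{Z_{n_0+n}}{Z_{n_0}}-n\mu}{\sigma\sqrt n}.$$ Then for all $0<x\le\frac{\sigma\sqrt n}{2}$, $$\mathbb{P}(Z_{n_0,n}\ge x)\le 2\exp\left\{-\frac{x}{2H}\left[\left(1+\frac{2\sigma\sqrt n}{Hx}\right)\ln\left(1+\frac{Hx}{2\sigma\sqrt n}\right)-1\right]\right\}\le 2\exp\left\{-\frac{x^2}{8\left(1+\frac{Hx}{6\sigma\sqrt n}\right)}\right\};$$ and for $x>\frac{\sigma\sqrt n}{2}$, $$\mathbb{P}(Z_{n_0,n}\ge x)\le \exp\left\{-\frac{x}{2H}\left[\left(1+\frac{2\sigma\sqrt n}{Hx}\right)\ln\left(1+\frac{Hx}{2\sigma\sqrt n}\right)-1\right]\right\}+\exp\left\{-\frac{x\sigma\sqrt n}{2}\right\}$$ $$\le \exp\left\{-\frac{x^2}{8\left(1+\frac{Hx}{6\sigma\sqrt n}\right)}\right\}+\exp\left\{-\frac{x\sigma\sqrt n}{2}\right\}.$$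
   Context: Branching process in a random environment: $\xi=(\xi_0,\xi_1,\dots)$ is a sequence of i.i.d. random variables (the environment). Each value of $\xi_n$ determines a probability distribution $p(\xi_n)=\{p_n(i): i\in\mathbb{N}\}$ on $\mathbb{N}=\{0,1,2,\dots\}$ (the offspring law at generation $n$). The process is defined by $Z_0=1$ and $Z_{n+1}=\sum_{i=1}^{Z_n}N_{n,i}$ for $n\ge 0$, where, conditionally on $\xi$, the variables $\{N_{n,i}: n\ge0,i\ge1\}$ are independent and, for each $n$, the $N_{n,i}$ $(i\ge1)$ have common law $p(\xi_n)$. $\mathbb{P}$ is the total (annealed) law, i.e. $\mathbb{P}(dx,d\xi)=\mathbb{P}_\xi(dx)\tau(d\xi)$ with $\mathbb{P}_\xi$ the conditional law given $\xi$ and $\tau$ the law of $\xi$; $\mathbb{E}$ is the corresponding expectation. Put $m_n=\sum_{i\ge0} i\,p_n(i)$ (conditional mean offspring number at generation $n$ given $\xi$), $X=\ln m_0$, $\mu=\mathbb{E}X$, $\sigma^2=\mathbb{E}(X-\mu)^2$, $\sigma>0$. Standing assumption: $p_0(0)=0$ almost surely (the probability of having no children is zero) and $0<\sigma^2<\infty$; hence $Z_n\ge1$ a.s. for all $n$.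
   Formalization: The prefactor x/(2H) before the bracket is replaced everywhere by xσ√n/(2H); as printed the bounds fail, e.g. for X equal to 0 or ln 2 with probability 1/2 each, n=10000, x=1, the second inequality is false. *)

theory Defs
  imports "HOL-Probability.Probability"
begin

primrec generation_size :: "(nat \<Rightarrow> nat \<Rightarrow> 'w \<Rightarrow> nat) \<Rightarrow> nat \<Rightarrow> 'w \<Rightarrow> nat" where
  "generation_size N 0 w = 1"
| "generation_size N (Suc n) w = (\<Sum>i = 1..generation_size N n w. N n i w)"

text \<open>Meaningful only for laws with finite mean (a divergent real series has an unspecified sum);
  finiteness is assumed explicitly wherever this is used.\<close>
definition offspring_mean :: "nat pmf \<Rightarrow> real" where
  "offspring_mean q = (\<Sum>i. real i * pmf q i)"

text \<open>The environment \<open>xi\<close> takes values in an arbitrary measurable space \<open>S\<close>, and \<open>p e\<close> is the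
  offspring law determined by the value \<open>e\<close>. The last assumption describes the conditional law of
  the offspring numbers given the sigma-algebra generated by the whole environment: they are
  conditionally independent and \<open>N n i\<close> has conditional law \<open>p (xi n)\<close>. As in the usual convention,
  individuals are numbered from 1, so \<open>N n 0\<close> is irrelevant.\<close>
locale branching_process_iid_environment = prob_space M
  for M :: "'w measure" +
  fixes S :: "'e measure"
    and p :: "'e \<Rightarrow> nat pmf"
    and xi :: "nat \<Rightarrow> 'w \<Rightarrow> 'e"
    and N :: "nat \<Rightarrow> nat \<Rightarrow> 'w \<Rightarrow> nat"
  assumes offspring_law_measurable: "\<And>k. (\<lambda>e. pmf (p e) k) \<in> borel_measurable S"
    and environment_indep: "indep_vars (\<lambda>_. S) xi UNIV"
    and environment_ident: "\<And>n. distr M S (xi n) = distr M S (xi 0)"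
    and offspring_random_variable:
      "\<And>n i. i \<ge> 1 \<Longrightarrow> random_variable (count_space UNIV) (N n i)"
    and offspring_conditional_law:
      "\<And>J B. finite J \<Longrightarrow> J \<subseteq> UNIV \<times> {1..} \<Longrightarrow>
        AE w in M.
          real_cond_exp M
            (vimage_algebra (space M) (\<lambda>w n. xi n w) (Pi\<^sub>M UNIV (\<lambda>_. S)))
            (indicator {w \<in> space M. \<forall>(n, i) \<in> J. N n i w \<in> B (n, i)}) w
          = (\<Prod>(n, i) \<in> J. measure_pmf.prob (p (xi n w)) (B (n, i)))"

end

theory Submission
  imports Defs
begin

text \<open>Write \<open>m\<^sub>j\<close> for the mean of the offspring law of generation \<open>j\<close>. Then
  \<open>ln (Z (n0 + n) / Z n0)\<close> is the sum of the i.i.d. variables \<open>ln m\<^sub>j\<close>, \<open>n0 \<le> j < n0 + n\<close>, and of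
  \<open>ln W\<close>, where \<open>W = Z (n0 + n) / (Z n0 * (\<Prod>j. m\<^sub>j))\<close> has expectation at most 1. If the whole exceeds
  \<open>n * mu + x * sigma * sqrt n\<close>, then the centred sum or \<open>ln W\<close> exceeds \<open>x * sigma * sqrt n / 2\<close>; Bennett's
  inequality bounds the first probability and Markov's inequality the second. The Bennett exponent is
  at most \<open>x\<^sup>2 / 8\<close>, so for small \<open>x\<close> the Bennett term dominates.\<close>

subsection \<open>Bennett's inequality\<close>

text \<open>Here h(u) = (1 + u) ln (1 + u) - u is Bennett's rate function. Each difference vanishes
  at 0, so it suffices to sign its derivative, which is y - ln (1 + y) for the upper bound. The
  lower bound, responsible for the Bernstein form, takes a second differentiation and ends in 27 (1
  + y) <= (3 + y)^3.\<close>

lemma bennett_function_bounds: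
  fixes u :: real
  assumes "0 \<le> u"
  shows bennett_function_le: "(1 + u) * ln (1 + u) - u \<le> u\<^sup>2 / 2"
    and bennett_function_ge: "u\<^sup>2 / (2 * (1 + u / 3)) \<le> (1 + u) * ln (1 + u) - u"
proof -
  have "(\<lambda>y. y\<^sup>2 / 2 - ((1 + y) * ln (1 + y) - y)) 0
      \<le> (\<lambda>y. y\<^sup>2 / 2 - ((1 + y) * ln (1 + y) - y)) u"
  proof (rule DERIV_nonneg_imp_nondecreasing[OF assms])
    fix y :: real assume y: "0 \<le> y" "y \<le> u"
    have "((\<lambda>y. y\<^sup>2 / 2 - ((1 + y) * ln (1 + y) - y)) has_real_derivative y - ln (1 + y)) (at y)"
      using y by (auto intro!: derivative_eq_intros)
    moreover have "0 \<le> y - ln (1 + y)" using ln_add_one_self_le_self[of y] y by simp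
    ultimately show "\<exists>D. ((\<lambda>y. y\<^sup>2 / 2 - ((1 + y) * ln (1 + y) - y)) has_real_derivative D) (at y) \<and> 0 \<le> D"
      by blast
  qed
  then show "(1 + u) * ln (1 + u) - u \<le> u\<^sup>2 / 2" by simp
next
  \<comment> \<open>\<open>k'\<close> is the derivative of the function \<open>k\<close> defined
    below. Its rational term is the derivative of 3 y^2 / (2 (3 + y)), which is y^2 / (2 (1 + y /
    3)) cleared of the inner fraction.\<close>
  define k' :: "real \<Rightarrow> real" where "k' y = ln (1 + y) - (3 * y\<^sup>2 + 18 * y) / (2 * (3 + y)\<^sup>2)" for y
  have k': "0 \<le> k' x" if "0 \<le> x" for x
  proof -
    have "k' 0 \<le> k' x"
    proof (rule DERIV_nonneg_imp_nondecreasing[OF that])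
      fix y :: real assume y: "0 \<le> y" "y \<le> x"
      have "(k' has_real_derivative 1 / (1 + y) - ((6 * y + 18) * (2 * (3 + y)\<^sup>2)
          - (3 * y\<^sup>2 + 18 * y) * (4 * (3 + y))) / (2 * (3 + y)\<^sup>2 * (2 * (3 + y)\<^sup>2))) (at y)"
        unfolding k'_def using y by (auto intro!: derivative_eq_intros)
      also have "(6 * y + 18) * (2 * (3 + y)\<^sup>2) - (3 * y\<^sup>2 + 18 * y) * (4 * (3 + y)) = 108 * (3 + y)"
        by (simp add: algebra_simps power2_eq_square)
      also have "108 * (3 + y) / (2 * (3 + y)\<^sup>2 * (2 * (3 + y)\<^sup>2)) = 27 / (3 + y) ^ 3"
        using y by (simp add: divide_simps power2_eq_square power3_eq_cube)
      finally have "(k' has_real_derivative 1 / (1 + y) - 27 / (3 + y) ^ 3) (at y)" .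
      moreover have "27 * (1 + y) \<le> (3 + y) ^ 3"
        using y by (simp add: power3_eq_cube algebra_simps)
      then have "0 \<le> 1 / (1 + y) - 27 / (3 + y) ^ 3"
        using y by (simp add: divide_simps)
      ultimately show "\<exists>D. (k' has_real_derivative D) (at y) \<and> 0 \<le> D" by blast
    qed
    then show ?thesis by (simp add: k'_def)
  qed
  define k :: "real \<Rightarrow> real" where "k y = (1 + y) * ln (1 + y) - y - 3 * y\<^sup>2 / (2 * (3 + y))" for y
  have "k 0 \<le> k u"
  proof (rule DERIV_nonneg_imp_nondecreasing[OF assms])
    fix y :: real assume y: "0 \<le> y" "y \<le> u"
    have "(k has_real_derivative ln (1 + y)
        - (6 * y * (2 * (3 + y)) - 3 * y\<^sup>2 * 2) / (2 * (3 + y) * (2 * (3 + y)))) (at y)"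
      unfolding k_def using y by (auto intro!: derivative_eq_intros)
    also have "6 * y * (2 * (3 + y)) - 3 * y\<^sup>2 * 2 = 2 * (3 * y\<^sup>2 + 18 * y)"
      by (simp add: algebra_simps power2_eq_square)
    also have "ln (1 + y) - 2 * (3 * y\<^sup>2 + 18 * y) / (2 * (3 + y) * (2 * (3 + y))) = k' y"
      using y by (simp add: k'_def divide_simps power2_eq_square) (simp add: algebra_simps)
    finally have "(k has_real_derivative k' y) (at y)" .
    then show "\<exists>D. (k has_real_derivative D) (at y) \<and> 0 \<le> D" using k'[of y] y by blast
  qed
  then show "u\<^sup>2 / (2 * (1 + u / 3)) \<le> (1 + u) * ln (1 + u) - u"
    using assms by (simp add: k_def field_simps)
qed

lemma exp_le_quadratic_nonpos:
  fixes z :: real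
  assumes "z \<le> 0"
  shows "exp z \<le> 1 + z + z\<^sup>2 / 2"
proof -
  have "(\<lambda>y. exp y - (1 + y + y\<^sup>2 / 2)) z \<le> (\<lambda>y. exp y - (1 + y + y\<^sup>2 / 2)) 0"
  proof (rule DERIV_nonneg_imp_nondecreasing[OF assms])
    fix y :: real
    have "((\<lambda>y. exp y - (1 + y + y\<^sup>2 / 2)) has_real_derivative exp y - (1 + y)) (at y)"
      by (auto intro!: derivative_eq_intros)
    moreover have "0 \<le> exp y - (1 + y)" using exp_ge_add_one_self[of y] by simp
    ultimately show "\<exists>D. ((\<lambda>y. exp y - (1 + y + y\<^sup>2 / 2)) has_real_derivative D) (at y) \<and> 0 \<le> D"
      by blast
  qed
  then show ?thesis by simp
qed

text \<open>The quotient (exp z - 1 - z) / z^2 increases with z, so its value at L dominates. For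
  negative z it is compared through its limit 1/2 at 0, for other z through the power series. Since
  z may be arbitrarily negative, a one-sided bound on a random variable will suffice.\<close>

lemma exp_remainder_quotient_le:
  fixes z L :: real
  assumes "z \<le> L" "0 < L"
  shows "exp z \<le> 1 + z + (exp L - 1 - L) / L\<^sup>2 * z\<^sup>2"
proof (cases "0 \<le> z")
  case False
  have half: "1 / 2 \<le> (exp L - 1 - L) / L\<^sup>2"
    using exp_lower_Taylor_quadratic[of L] assms by (simp add: field_simps)
  then have "z\<^sup>2 / 2 \<le> (exp L - 1 - L) / L\<^sup>2 * z\<^sup>2"
    using mult_right_mono[OF half, of "z\<^sup>2"] by simp
  then show ?thesis using exp_le_quadratic_nonpos[of z] False by linarith
next
  case True
  \<comment> \<open>With z = s L and 0 <= s <= 1, the power z^(n + 2) is s^2 s^n L^(n + 2). Bounding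
    s^n by 1 leaves the common factor s^2 in every term.\<close>
  define s where "s = z / L"
  have s: "0 \<le> s" "s \<le> 1" "z = s * L" using assms True by (auto simp: s_def)
  have sm: "summable (\<lambda>n. inverse (fact (n + 2)) * (y ^ (n + 2)))" for y :: real
    using summable_exp_generic[of y] by (subst summable_iff_shift[where k = 2]) simp
  have "(\<Sum>n. inverse (fact (n + 2)) * (z ^ (n + 2)))
      \<le> (\<Sum>n. s\<^sup>2 * (inverse (fact (n + 2)) * (L ^ (n + 2))))"
  proof (rule suminf_le[OF _ sm summable_mult[OF sm]])
    fix n
    have "z ^ (n + 2) = s\<^sup>2 * (s ^ n * L ^ (n + 2))"
      by (simp add: s(3) power_mult_distrib power_add power2_eq_square mult_ac)
    also have "\<dots> \<le> s\<^sup>2 * (1 * L ^ (n + 2))"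
      using s assms by (intro mult_left_mono mult_right_mono power_le_one) auto
    finally show "inverse (fact (n + 2)) * z ^ (n + 2) \<le> s\<^sup>2 * (inverse (fact (n + 2)) * L ^ (n + 2))"
      using mult_left_mono[of "z ^ (n + 2)" "s\<^sup>2 * (1 * L ^ (n + 2))" "inverse (fact (n + 2))"]
      by (simp only: mult_ac) simp
  qed
  also have "\<dots> = s\<^sup>2 * (\<Sum>n. inverse (fact (n + 2)) * (L ^ (n + 2)))"
    by (rule suminf_mult[OF sm])
  finally have "exp z - 1 - z \<le> s\<^sup>2 * (exp L - 1 - L)"
    using exp_first_two_terms[of z] exp_first_two_terms[of L] by simp
  then show ?thesis using assms by (simp add: s_def power_divide mult.commute)
qed

text \<open>The preceding quadratic bound is integrated with z = l Y and L = l H: the linear term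
  has mean 0, and 1 + a <= exp a. As l > 0, the upper bound on Y alone makes exp (l Y) bounded,
  hence integrable.\<close>

lemma (in prob_space) bennett_mgf_bound:
  fixes Y :: "'a \<Rightarrow> real"
  assumes Y: "integrable M Y" "integrable M (\<lambda>w. (Y w)\<^sup>2)" "expectation Y = 0"
    and bound: "AE w in M. Y w \<le> H" and pos: "0 < H" "0 < l"
  shows "integrable M (\<lambda>w. exp (l * Y w))"
    and "expectation (\<lambda>w. exp (l * Y w))
          \<le> exp (expectation (\<lambda>w. (Y w)\<^sup>2) / H\<^sup>2 * (exp (l * H) - 1 - l * H))"
proof -
  have [measurable]: "Y \<in> borel_measurable M" using Y(1) by auto
  show int: "integrable M (\<lambda>w. exp (l * Y w))"
    using bound pos by (intro integrable_const_bound[where B = "exp (l * H)"]) (auto elim!: eventually_mono)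
  define C where "C = (exp (l * H) - 1 - l * H) / (l * H)\<^sup>2"
  have "AE w in M. exp (l * Y w) \<le> 1 + l * Y w + C * (l * Y w)\<^sup>2"
    using bound
  proof eventually_elim
    case (elim w)
    then show ?case unfolding C_def using pos by (intro exp_remainder_quotient_le) auto
  qed
  then have "expectation (\<lambda>w. exp (l * Y w)) \<le> expectation (\<lambda>w. 1 + l * Y w + C * (l * Y w)\<^sup>2)"
    using int Y by (intro integral_mono_AE) (auto simp: power_mult_distrib)
  also have "\<dots> = 1 + C * l\<^sup>2 * expectation (\<lambda>w. (Y w)\<^sup>2)"
    using Y by (simp add: power_mult_distrib prob_space)
  also have "\<dots> \<le> exp (C * l\<^sup>2 * expectation (\<lambda>w. (Y w)\<^sup>2))"
    by (rule exp_ge_add_one_self)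
  also have "C * l\<^sup>2 * expectation (\<lambda>w. (Y w)\<^sup>2)
      = expectation (\<lambda>w. (Y w)\<^sup>2) / H\<^sup>2 * (exp (l * H) - 1 - l * H)"
    using pos by (simp add: C_def power_mult_distrib)
  finally show "expectation (\<lambda>w. exp (l * Y w))
      \<le> exp (expectation (\<lambda>w. (Y w)\<^sup>2) / H\<^sup>2 * (exp (l * H) - 1 - l * H))" .
qed

text \<open>Chernoff's method: Markov's inequality for exp (l * sum), which factorizes by
  independence. The variances add up in the exponent, so only their sum V appears.\<close>

lemma (in prob_space) bennett_inequality:
  fixes Y :: "'i \<Rightarrow> 'a \<Rightarrow> real"
  assumes I: "finite I" and indep: "indep_vars (\<lambda>_. borel) Y I"
    and int: "\<And>i. i \<in> I \<Longrightarrow> integrable M (Y i)"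
    and int2: "\<And>i. i \<in> I \<Longrightarrow> integrable M (\<lambda>w. (Y i w)\<^sup>2)"
    and mean: "\<And>i. i \<in> I \<Longrightarrow> expectation (Y i) = 0"
    and bound: "\<And>i. i \<in> I \<Longrightarrow> AE w in M. Y i w \<le> H"
    and V: "V = (\<Sum>i\<in>I. expectation (\<lambda>w. (Y i w)\<^sup>2))"
    and pos: "0 < V" "0 < H" "0 < t"
  shows "prob {w \<in> space M. t \<le> (\<Sum>i\<in>I. Y i w)}
    \<le> exp (- (V / H\<^sup>2 * ((1 + H * t / V) * ln (1 + H * t / V) - H * t / V)))"
proof -
  define u where "u = H * t / V"
  \<comment> \<open>This \<open>l\<close> minimizes V / H^2 (exp (l H) - 1 - l H) - l t; the
    derivative vanishes where exp (l H) = 1 + H t / V.\<close>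
  define l where "l = ln (1 + u) / H"
  have u: "0 < u" using pos by (simp add: u_def)
  have l: "0 < l" using u pos by (simp add: l_def)
  have indep': "indep_vars (\<lambda>_. borel) (\<lambda>i w. exp (l * Y i w)) I"
    by (rule indep_vars_compose2[OF indep]) simp
  have mgf_int: "\<And>i. i \<in> I \<Longrightarrow> integrable M (\<lambda>w. exp (l * Y i w))"
    and mgf_le: "\<And>i. i \<in> I \<Longrightarrow> expectation (\<lambda>w. exp (l * Y i w))
          \<le> exp (expectation (\<lambda>w. (Y i w)\<^sup>2) / H\<^sup>2 * (exp (l * H) - 1 - l * H))"
    using bennett_mgf_bound[OF int int2 mean bound pos(2) l] by auto
  have prod_exp: "(\<Prod>i\<in>I. exp (l * Y i w)) = exp (l * (\<Sum>i\<in>I. Y i w))" for w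
    by (simp add: exp_sum I sum_distrib_left)
  have int_prod: "integrable M (\<lambda>w. exp (l * (\<Sum>i\<in>I. Y i w)))"
    using indep_vars_integrable[OF I indep' mgf_int] by (simp add: prod_exp)
  have "{w \<in> space M. t \<le> (\<Sum>i\<in>I. Y i w)}
      = {w \<in> space M. exp (l * t) \<le> exp (l * (\<Sum>i\<in>I. Y i w))}"
    using l by simp
  also have "prob \<dots> \<le> expectation (\<lambda>w. exp (l * (\<Sum>i\<in>I. Y i w))) / exp (l * t)"
    by (rule integral_Markov_inequality_measure[where A = "{}"]) (use int_prod in auto)
  also have "expectation (\<lambda>w. exp (l * (\<Sum>i\<in>I. Y i w))) = (\<Prod>i\<in>I. expectation (\<lambda>w. exp (l * Y i w)))"
    using indep_vars_lebesgue_integral[OF I indep' mgf_int] by (simp add: prod_exp)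
  also have "\<dots> \<le> (\<Prod>i\<in>I. exp (expectation (\<lambda>w. (Y i w)\<^sup>2) / H\<^sup>2 * (exp (l * H) - 1 - l * H)))"
    by (intro prod_mono conjI integral_nonneg_AE mgf_le) auto
  also have "\<dots> = exp (V / H\<^sup>2 * (exp (l * H) - 1 - l * H))"
    by (simp add: V exp_sum[OF I, symmetric] sum_distrib_right sum_divide_distrib)
  also have "exp (l * H) = 1 + u" using u pos by (simp add: l_def)
  also have "exp (V / H\<^sup>2 * (1 + u - 1 - l * H)) / exp (l * t)
      = exp (V / H\<^sup>2 * (u - l * H) - l * t)" by (simp add: exp_diff)
  also have "V / H\<^sup>2 * (u - l * H) - l * t = - (V / H\<^sup>2 * ((1 + u) * ln (1 + u) - u))"
  proof -
    have "l * t = V / H\<^sup>2 * (u * ln (1 + u))"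
      using pos by (simp add: l_def u_def power2_eq_square)
    moreover have "l * H = ln (1 + u)" using pos by (simp add: l_def)
    ultimately show ?thesis by (simp add: algebra_simps diff_divide_distrib add_divide_distrib)
  qed
  finally show ?thesis by (simp add: u_def divide_right_mono)
qed

text \<open>Bennett's inequality will be used with V = c^2 and t = x c / 2, half of the deviation,
  where c is sigma * sqrt n. Its parameter H t / V is then u = H x / (2 c), and the rate is c^2 /
  H^2 times the rate function at u. Since c^2 / H^2 * u^2 / 2 = x^2 / 8, the bounds on the rate
  function give the last two claims.\<close>

lemma bennett_rate:
  fixes c H x :: real
  assumes pos: "0 < c" "0 < H" "0 < x"
  defines "R \<equiv> x * c / (2 * H) * ((1 + 2 * c / (H * x)) * ln (1 + H * x / (2 * c)) - 1)"
  shows bennett_rate_eq: "c\<^sup>2 / H\<^sup>2 * ((1 + H * (x * c / 2) / c\<^sup>2) * ln (1 + H * (x * c / 2) / c\<^sup>2)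
      - H * (x * c / 2) / c\<^sup>2) = R"
    and bennett_rate_ge: "x\<^sup>2 / (8 * (1 + H * x / (6 * c))) \<le> R"
    and bennett_rate_le: "R \<le> x\<^sup>2 / 8"
proof -
  define u where "u = H * x / (2 * c)"
  have u: "0 < u" using pos by (simp add: u_def)
  have x: "x = 2 * c * u / H" using pos by (simp add: u_def)
  have "2 * c / (H * x) = 1 / u" by (simp add: u_def)
  moreover have "x * c / (2 * H) = c\<^sup>2 / H\<^sup>2 * u" using pos by (simp add: x power2_eq_square)
  ultimately have "R = c\<^sup>2 / H\<^sup>2 * u * ((1 + 1 / u) * ln (1 + u) - 1)"
    by (simp add: R_def u_def)
  also have "\<dots> = c\<^sup>2 / H\<^sup>2 * ((1 + u) * ln (1 + u) - u)"
  proof -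
    have "u * ((1 + 1 / u) * ln (1 + u) - 1) = (1 + u) * ln (1 + u) - u"
      using u by (simp add: field_simps)
    then show ?thesis by (simp only: mult.assoc)
  qed
  finally have R: "R = c\<^sup>2 / H\<^sup>2 * ((1 + u) * ln (1 + u) - u)" .
  have "H * (x * c / 2) / c\<^sup>2 = u" using pos by (simp add: u_def power2_eq_square)
  then show "c\<^sup>2 / H\<^sup>2 * ((1 + H * (x * c / 2) / c\<^sup>2) * ln (1 + H * (x * c / 2) / c\<^sup>2)
      - H * (x * c / 2) / c\<^sup>2) = R"
    by (simp only: R)
  have "x\<^sup>2 / (8 * (1 + H * x / (6 * c))) = c\<^sup>2 / H\<^sup>2 * (u\<^sup>2 / (2 * (1 + u / 3)))"
  proof -
    have "H * x / (6 * c) = u / 3" using pos by (simp add: x)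
    moreover have "x\<^sup>2 / (8 * v) = c\<^sup>2 / H\<^sup>2 * (u\<^sup>2 / (2 * v))" for v
      by (simp add: x power_mult_distrib power_divide)
    ultimately show ?thesis by (simp only:)
  qed
  also have "\<dots> \<le> R"
    unfolding R using u by (intro mult_left_mono bennett_function_ge) auto
  finally show "x\<^sup>2 / (8 * (1 + H * x / (6 * c))) \<le> R" .
  have "R \<le> c\<^sup>2 / H\<^sup>2 * (u\<^sup>2 / 2)"
    unfolding R using u by (intro mult_left_mono bennett_function_le) auto
  also have "\<dots> = x\<^sup>2 / 8"
    using pos by (simp add: x power_mult_distrib power_divide)
  finally show "R \<le> x\<^sup>2 / 8" .
qed

subsection \<open>Offspring laws and generation sizes\<close>

text \<open>The measurable space is arbitrary and only litters before generation k enter, so this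
  serves both \<open>M\<close> and the space of histories. A sum with a random number of terms is
  treated by fixing the upper limit z and splitting over the countably many generation
  sizes.\<close>

lemma measurable_generation_size:
  fixes N :: "nat \<Rightarrow> nat \<Rightarrow> 'a \<Rightarrow> nat"
  assumes "\<And>j i. j < k \<Longrightarrow> 1 \<le> i \<Longrightarrow> N j i \<in> A \<rightarrow>\<^sub>M count_space UNIV"
  shows "generation_size N k \<in> A \<rightarrow>\<^sub>M count_space UNIV"
  using assms
proof (induction k)
  case 0
  show ?case by simp
next
  case (Suc k)
  have N: "N k i \<in> A \<rightarrow>\<^sub>M count_space UNIV" if "1 \<le> i" for i
    using Suc.prems that by simp
  have "(\<lambda>w. \<Sum>i = 1..z. N k i w) \<in> A \<rightarrow>\<^sub>M count_space UNIV" for z :: nat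
  proof (induction z)
    case (Suc z)
    have "(\<lambda>w. a + N k (Suc z) w) \<in> A \<rightarrow>\<^sub>M count_space UNIV" for a
      by (rule measurable_compose[OF N]) auto
    from measurable_compose_countable[OF this Suc.IH] show ?case by simp
  qed simp
  moreover have "generation_size N k \<in> A \<rightarrow>\<^sub>M count_space UNIV"
    using Suc by auto
  ultimately show ?case
    by (simp add: measurable_compose_countable[where f = "\<lambda>z w. \<Sum>i = 1..z. N k i w"])
qed

lemma measurable_pmf_prob:
  fixes p :: "'e \<Rightarrow> nat pmf"
  assumes [measurable]: "\<And>k. (\<lambda>e. pmf (p e) k) \<in> borel_measurable A"
  shows "(\<lambda>e. measure_pmf.prob (p e) B) \<in> borel_measurable A"
proof -
  have "emeasure (measure_pmf q) B = (\<Sum>k. ennreal (pmf q k) * indicator B k)" for q :: "nat pmf"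
  proof -
    have "emeasure (measure_pmf q) B = (\<integral>\<^sup>+k. indicator B k \<partial>measure_pmf q)" by simp
    also have "\<dots> = (\<Sum>k. ennreal (pmf q k) * indicator B k)"
      by (simp only: nn_integral_measure_pmf nn_integral_count_space_nat)
    finally show ?thesis .
  qed
  then have "measure_pmf.prob q B = enn2real (\<Sum>k. ennreal (pmf q k) * indicator B k)" for q :: "nat pmf"
    by (simp add: measure_def)
  then show ?thesis by simp
qed

lemma measurable_offspring_mean:
  assumes [measurable]: "\<And>k. (\<lambda>e. pmf (p e) k) \<in> borel_measurable A"
  shows "(\<lambda>e. offspring_mean (p e)) \<in> borel_measurable A"
  unfolding offspring_mean_def by measurable

text \<open>Without mass at 0, every i in the support is at least 1. Consequently the reciprocal
  means used for normalization are at most 1.\<close>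

lemma offspring_mean_ge_1:
  assumes sm: "summable (\<lambda>i. real i * pmf q i)" and zero: "pmf q 0 = 0"
  shows "1 \<le> offspring_mean q"
proof -
  have 1: "pmf q sums 1"
    using sums_infsetsum_nat[of "pmf q" UNIV] pmf_abs_summable[of q UNIV]
    by (simp add: infsetsum_pmf_eq_1)
  have "(\<Sum>i. pmf q i) \<le> (\<Sum>i. real i * pmf q i)"
  proof (rule suminf_le[OF _ sums_summable[OF 1] sm])
    fix i show "pmf q i \<le> real i * pmf q i"
      using zero by (cases "i = 0") (auto simp: mult_le_cancel_right1)
  qed
  then show ?thesis using sums_unique[OF 1] by (simp add: offspring_mean_def)
qed

lemma ennreal_offspring_mean:
  assumes "summable (\<lambda>i. real i * pmf q i)"
  shows "ennreal (offspring_mean q) = (\<Sum>i. ennreal (real i * pmf q i))"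
  unfolding offspring_mean_def by (rule suminf_ennreal2[symmetric]) (use assms in auto)

text \<open>This serves measurability: convergence of the mean becomes a condition on a measurable
  extended nonnegative series, so that it can be carried from one generation to another through the
  law.\<close>

lemma summable_mean_iff:
  "summable (\<lambda>i. real i * pmf q i) \<longleftrightarrow> (\<Sum>i. ennreal (real i * pmf q i)) \<noteq> \<top>"
proof
  assume "summable (\<lambda>i. real i * pmf q i)"
  then show "(\<Sum>i. ennreal (real i * pmf q i)) \<noteq> \<top>"
    by (rule ennreal_suminf_neq_top) simp
next
  assume "(\<Sum>i. ennreal (real i * pmf q i)) \<noteq> \<top>"
  then show "summable (\<lambda>i. real i * pmf q i)"
    by (intro summable_suminf_not_top) auto
qed

lemma of_nat_eq_suminf_indicator:
  "(of_nat n :: ennreal) = (\<Sum>v. of_nat v * indicator {v} n)"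
proof -
  have "(\<Sum>v. of_nat v * indicator {v} n :: ennreal) = (\<Sum>v\<in>{n}. of_nat v * indicator {v} n)"
    by (rule suminf_finite) auto
  then show ?thesis by simp
qed

context branching_process_iid_environment
begin

subsection \<open>Conditioning on the environment\<close>

abbreviation env_algebra :: "'w measure" where
  "env_algebra \<equiv> vimage_algebra (space M) (\<lambda>w n. xi n w) (Pi\<^sub>M UNIV (\<lambda>_. S))"

abbreviation env_mean :: "nat \<Rightarrow> 'w \<Rightarrow> real" where
  "env_mean n w \<equiv> offspring_mean (p (xi n w))"

lemma measurable_xi [measurable]: "xi n \<in> M \<rightarrow>\<^sub>M S"
  using environment_indep by (auto simp: indep_vars_def)

lemma xi_in_space: "(\<lambda>w n. xi n w) \<in> space M \<rightarrow> space (Pi\<^sub>M UNIV (\<lambda>_. S))"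
  using measurable_space[OF measurable_xi] by (auto simp: space_PiM PiE_def)

lemma measurable_xi_env: "xi n \<in> env_algebra \<rightarrow>\<^sub>M S"
  using measurable_compose[OF measurable_vimage_algebra1[OF xi_in_space]
      measurable_component_singleton[of n UNIV "\<lambda>_. S"]] by simp

lemma subalgebra_env: "subalgebra M env_algebra"
proof -
  have "(\<lambda>w. w) \<in> M \<rightarrow>\<^sub>M env_algebra"
    by (rule measurable_vimage_algebra2) (auto intro!: measurable_PiM_single' simp: space_PiM PiE_def
        intro: measurable_space[OF measurable_xi])
  from measurable_sets[OF this] have "A \<in> sets M" if "A \<in> sets env_algebra" for A
    using that sets.sets_into_space[OF that] by (force simp: Int_absorb2)
  then show ?thesis by (auto simp: subalgebra_def)
qed

lemma measurable_env_imp: "g \<in> borel_measurable env_algebra \<Longrightarrow> g \<in> borel_measurable M"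
  by (rule measurable_from_subalg[OF subalgebra_env])

lemma measurable_N [measurable]: "1 \<le> i \<Longrightarrow> N n i \<in> M \<rightarrow>\<^sub>M count_space UNIV"
  by (rule offspring_random_variable)

lemma measurable_pmf_xi_env [measurable]:
  "(\<lambda>w. pmf (p (xi n w)) v) \<in> borel_measurable env_algebra"
  using measurable_compose[OF measurable_xi_env offspring_law_measurable] .

lemma measurable_env_mean_env [measurable]: "env_mean n \<in> borel_measurable env_algebra"
  by (rule measurable_offspring_mean[where p = "\<lambda>w. p (xi n w)"]) (rule measurable_pmf_xi_env)

text \<open>The laws of \<open>xi n\<close> and \<open>xi 0\<close> agree on the set of values
  satisfying \<open>P\<close>; its measurability turns an almost sure statement into one about the
  law.\<close>

lemma AE_xi:
  assumes P: "{e \<in> space S. P e} \<in> sets S" and AE0: "AE w in M. P (xi 0 w)"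
  shows "AE w in M. P (xi n w)"
proof -
  have "AE e in distr M S (xi n). P e"
    using AE0 by (simp only: environment_ident[of n] AE_distr_iff[OF measurable_xi P])
  then show ?thesis by (simp only: AE_distr_iff[OF measurable_xi P])
qed

lemma AE_summable_mean:
  assumes "AE w in M. summable (\<lambda>i. real i * pmf (p (xi 0 w)) i)"
  shows "AE w in M. summable (\<lambda>i. real i * pmf (p (xi n w)) i)"
proof (rule AE_xi[OF _ assms])
  note offspring_law_measurable [measurable]
  show "{e \<in> space S. summable (\<lambda>i. real i * pmf (p e) i)} \<in> sets S"
    unfolding summable_mean_iff by measurable
qed

lemma AE_no_empty_litter:
  assumes "AE w in M. pmf (p (xi 0 w)) 0 = 0"
  shows "AE w in M. pmf (p (xi n w)) 0 = 0"
proof (rule AE_xi[OF _ assms])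
  note offspring_law_measurable [measurable]
  show "{e \<in> space S. pmf (p e) 0 = 0} \<in> sets S" by measurable
qed

lemma sets_offspring_cylinder:
  assumes "finite J" "J \<subseteq> UNIV \<times> {1..}"
  shows "{w \<in> space M. \<forall>(n, i) \<in> J. N n i w \<in> B (n, i)} \<in> events"
proof -
  have "{w \<in> space M. N (fst x) (snd x) w \<in> B x} \<in> events" if "x \<in> J" for x
  proof -
    have [measurable]: "N (fst x) (snd x) \<in> M \<rightarrow>\<^sub>M count_space UNIV"
      using that assms by (intro measurable_N) auto
    show ?thesis by measurable
  qed
  then have "{w \<in> space M. \<forall>x \<in> J. N (fst x) (snd x) w \<in> B x} \<in> events"
    by (intro sets.sets_Collect_finite_All assms) auto
  then show ?thesis by (simp add: case_prod_beta)
qed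

text \<open>As \<open>g\<close> is measurable with respect to the environment, the indicator may be
  replaced under the integral by its conditional expectation, which is the product of offspring
  probabilities.\<close>

lemma integral_offspring_cylinder:
  assumes g: "g \<in> borel_measurable env_algebra" and int: "integrable M g"
    and J: "finite J" "J \<subseteq> UNIV \<times> {1..}"
  shows "(\<integral>w. g w * indicator {w \<in> space M. \<forall>(n, i) \<in> J. N n i w \<in> B (n, i)} w \<partial>M)
    = (\<integral>w. g w * (\<Prod>(n, i) \<in> J. measure_pmf.prob (p (xi n w)) (B (n, i))) \<partial>M)"
    (is "(\<integral>w. g w * indicator ?A w \<partial>M) = (\<integral>w. g w * ?q w \<partial>M)")
proof -
  interpret env: finite_measure_subalgebra M env_algebra
    by standard (rule subalgebra_env)
  note measurable_env_imp[OF g, measurable]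
  note sets_offspring_cylinder[OF J, of B, measurable]
  have "(\<integral>w. g w * indicator ?A w \<partial>M) = (\<integral>w. g w * real_cond_exp M env_algebra (indicator ?A) w \<partial>M)"
    using int by (intro env.real_cond_exp_intg(2)[symmetric] integrable_real_mult_indicator g) auto
  also have "\<dots> = (\<integral>w. g w * ?q w \<partial>M)"
  proof (rule integral_cong_AE)
    show "(\<lambda>w. g w * real_cond_exp M env_algebra (indicator ?A) w) \<in> borel_measurable M"
      by measurable
    have "(\<lambda>w. measure_pmf.prob (p (xi n w)) C) \<in> borel_measurable M" for n C
      by (rule measurable_compose[OF measurable_xi measurable_pmf_prob[OF offspring_law_measurable]])
    then show "(\<lambda>w. g w * ?q w) \<in> borel_measurable M"
      by (intro borel_measurable_times borel_measurable_prod) (auto split: prod.split)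
    show "AE w in M. g w * real_cond_exp M env_algebra (indicator ?A) w = g w * ?q w"
      using offspring_conditional_law[OF J, of B] by eventually_elim simp
  qed
  finally show ?thesis .
qed

text \<open>Given the environment, a litter of generation k is independent of earlier generations.
  The cylinder formula is applied to \<open>J\<close> enlarged by (k, i), the new factor is
  environment-measurable and joins \<open>g\<close>, and the formula is applied backwards to
  \<open>J\<close>.\<close>

lemma integral_offspring_insert:
  assumes g: "g \<in> borel_measurable env_algebra" and int: "integrable M g"
    and J: "finite J" "J \<subseteq> {..<k} \<times> {1..}" and i: "1 \<le> i"
  shows "(\<integral>w. g w * (indicator {v} (N k i w)
            * indicator {w \<in> space M. \<forall>(n, i) \<in> J. N n i w \<in> B (n, i)} w) \<partial>M)
    = (\<integral>w. g w * pmf (p (xi k w)) v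
            * indicator {w \<in> space M. \<forall>(n, i) \<in> J. N n i w \<in> B (n, i)} w \<partial>M)"
proof -
  \<comment> \<open>The enlarged cylinder prescribes v at the new index. \<open>J\<close> involves
    generations before k only, so no earlier constraint changes.\<close>
  define B' where "B' = B((k, i) := {v})"
  have new: "(k, i) \<notin> J" using J by auto
  have J': "finite (insert (k, i) J)" "insert (k, i) J \<subseteq> UNIV \<times> {1..}" "J \<subseteq> UNIV \<times> {1..}"
    using J i by auto
  have B': "B' (n, l) = B (n, l)" if "(n, l) \<in> J" for n l using that new by (auto simp: B'_def)
  have B'_new: "B' (k, i) = {v}" by (simp add: B'_def)
  have "(\<integral>w. g w * (indicator {v} (N k i w)
            * indicator {w \<in> space M. \<forall>(n, i) \<in> J. N n i w \<in> B (n, i)} w) \<partial>M)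
      = (\<integral>w. g w * indicator {w \<in> space M. \<forall>(n, i) \<in> insert (k, i) J. N n i w \<in> B' (n, i)} w \<partial>M)"
    by (intro Bochner_Integration.integral_cong refl)
       (auto simp: B' B'_new split: split_indicator)
  also have "\<dots> = (\<integral>w. g w * (\<Prod>(n, i) \<in> insert (k, i) J. measure_pmf.prob (p (xi n w)) (B' (n, i))) \<partial>M)"
    by (rule integral_offspring_cylinder[OF g int J'(1,2)])
  also have "\<dots> = (\<integral>w. (g w * pmf (p (xi k w)) v)
      * (\<Prod>(n, i) \<in> J. measure_pmf.prob (p (xi n w)) (B (n, i))) \<partial>M)"
  proof (intro Bochner_Integration.integral_cong refl)
    fix w
    have "(\<Prod>(n, i) \<in> J. measure_pmf.prob (p (xi n w)) (B' (n, i)))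
        = (\<Prod>(n, i) \<in> J. measure_pmf.prob (p (xi n w)) (B (n, i)))"
      by (rule prod.cong) (auto simp: B')
    then show "g w * (\<Prod>(n, i) \<in> insert (k, i) J. measure_pmf.prob (p (xi n w)) (B' (n, i)))
      = (g w * pmf (p (xi k w)) v) * (\<Prod>(n, i) \<in> J. measure_pmf.prob (p (xi n w)) (B (n, i)))"
      using J(1) new by (simp add: B'_new measure_pmf_single)
  qed
  also have "\<dots> = (\<integral>w. g w * pmf (p (xi k w)) v
            * indicator {w \<in> space M. \<forall>(n, i) \<in> J. N n i w \<in> B (n, i)} w \<partial>M)"
  proof (rule integral_offspring_cylinder[symmetric, OF _ _ J(1) J'(3)])
    show 1: "(\<lambda>w. g w * pmf (p (xi k w)) v) \<in> borel_measurable env_algebra"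
      using g by measurable
    show "integrable M (\<lambda>w. g w * pmf (p (xi k w)) v)"
      by (rule Bochner_Integration.integrable_bound[OF int])
         (auto simp: measurable_env_imp[OF 1] abs_mult pmf_le_1 mult_left_le)
  qed
  finally show ?thesis .
qed

section \<open>Histories of the population and averaging over the next generation\<close>

abbreviation history_space :: "nat \<Rightarrow> (nat \<times> nat \<Rightarrow> nat) measure" where
  "history_space k \<equiv> Pi\<^sub>M ({..<k} \<times> {1..}) (\<lambda>_. count_space UNIV)"

text \<open>Litters of individuals that never exist are recorded too: generation sizes are
  unbounded, and a product space calls for a fixed index set.\<close>

definition history :: "nat \<Rightarrow> 'w \<Rightarrow> nat \<times> nat \<Rightarrow> nat" where
  "history k w = (\<lambda>(j, l) \<in> {..<k} \<times> {1..}. N j l w)"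

abbreviation past_size :: "nat \<Rightarrow> (nat \<times> nat \<Rightarrow> nat) \<Rightarrow> nat" where
  "past_size \<equiv> generation_size (\<lambda>j l \<omega>. \<omega> (j, l))"

lemma measurable_history [measurable]: "history k \<in> M \<rightarrow>\<^sub>M history_space k"
  unfolding history_def by (intro measurable_restrict) (auto split: prod.split intro!: measurable_N)

text \<open>Generation j is formed from litters of generations 0 to j - 1, so the history before k
  already determines generation k. Hence the current population size counts as past when the litters
  \<open>N k i\<close> are averaged.\<close>

lemma past_size_history: "j \<le> k \<Longrightarrow> past_size j (history k w) = generation_size N j w"
proof (induction j)
  case (Suc j)
  then show ?case by (auto simp: history_def intro!: sum.cong)
qed simp

lemma measurable_past_size:
  assumes "j \<le> k"
  shows "past_size j \<in> history_space k \<rightarrow>\<^sub>M count_space UNIV"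
proof (rule measurable_generation_size)
  fix i l assume "i < j" "(1::nat) \<le> l"
  then show "(\<lambda>\<omega>. \<omega> (i, l)) \<in> history_space k \<rightarrow>\<^sub>M count_space UNIV"
    using assms by (intro measurable_component_singleton) auto
qed

lemma measurable_population [measurable]: "generation_size N k \<in> M \<rightarrow>\<^sub>M count_space UNIV"
  by (rule measurable_generation_size) simp

text \<open>The cylinders generating the history space pull back to exactly the kind of event
  described by the assumed conditional law.\<close>

lemma vimage_history_prod_emb:
  assumes "J \<subseteq> {..<k} \<times> {1..}"
  shows "history k -` prod_emb ({..<k} \<times> {1..}) (\<lambda>_. count_space UNIV) J (Pi\<^sub>E J A) \<inter> space M
    = {w \<in> space M. \<forall>(n, i) \<in> J. N n i w \<in> A (n, i)}"
proof -
  have "history k w x = N (fst x) (snd x) w" if "x \<in> J" for x w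
    using that assms by (auto simp: history_def case_prod_beta)
  then have "(\<forall>x\<in>J. history k w x \<in> A x) \<longleftrightarrow> (\<forall>(n, i)\<in>J. N n i w \<in> A (n, i))" for w
    by (intro ball_cong) (auto simp: case_prod_beta)
  moreover have "history k w \<in> extensional ({..<k} \<times> {1..})" for w
    by (simp add: history_def)
  ultimately show ?thesis
    using assms by (auto simp: prod_emb_def PiE_iff)
qed

lemma measurable_indicator_N:
  fixes v :: nat
  assumes "1 \<le> i"
  shows "(\<lambda>w. indicator {v} (N n i w) :: 'b::{zero_neq_one, topological_space}) \<in> borel_measurable M"
  by (rule measurable_compose[OF measurable_N[OF assms]]) simp

text \<open>Both sides integrate \<open>h\<close> against finite measures on histories; these agree on cylinders, which is the
  assumed conditional law, and hence everywhere.\<close>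

lemma nn_integral_offspring_history:
  assumes g: "g \<in> borel_measurable env_algebra" "\<And>w. 0 \<le> g w" and int: "integrable M g"
    and i: "1 \<le> i" and h: "h \<in> borel_measurable (history_space k)"
  shows "(\<integral>\<^sup>+w. ennreal (g w) * indicator {v} (N k i w) * h (history k w) \<partial>M)
    = (\<integral>\<^sup>+w. ennreal (g w * pmf (p (xi k w)) v) * h (history k w) \<partial>M)"
proof -
  note measurable_env_imp[OF g(1), measurable] measurable_env_imp[OF measurable_pmf_xi_env, measurable]
  note measurable_indicator_N[OF i, measurable]
  define f1 where "f1 = (\<lambda>w. g w * indicator {v} (N k i w))"
  define f2 where "f2 = (\<lambda>w. g w * pmf (p (xi k w)) v)"
  have [measurable]: "f1 \<in> borel_measurable M" "f2 \<in> borel_measurable M"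
    by (auto simp: f1_def f2_def)
  have f_int: "integrable M f1" "integrable M f2"
    unfolding f1_def f2_def
    by (auto intro!: Bochner_Integration.integrable_bound[OF int] simp: abs_mult pmf_le_1 mult_left_le
        split: split_indicator)
  have f_nonneg: "0 \<le> f1 w" "0 \<le> f2 w" for w using g(2) by (auto simp: f1_def f2_def)
  define P where "P f = distr (density M (\<lambda>w. ennreal (f w))) (history_space k) (history k)" for f
  have "P f1 = P f2"
  proof (rule measure_eqI_PiM_infinite)
    fix J :: "(nat \<times> nat) set" and A :: "nat \<times> nat \<Rightarrow> nat set"
    assume J: "finite J" "J \<subseteq> {..<k} \<times> {1..}"
    let ?X = "prod_emb ({..<k} \<times> {1..}) (\<lambda>_. count_space UNIV) J (Pi\<^sub>E J A)"
    let ?E = "{w \<in> space M. \<forall>(n, i) \<in> J. N n i w \<in> A (n, i)}"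
    have X: "?X \<in> sets (history_space k)" using J by (intro sets_PiM_I) auto
    have J': "J \<subseteq> UNIV \<times> {1..}" using J by auto
    note E = sets_offspring_cylinder[OF J(1) J', of A]
    have "P f ?X = ennreal (\<integral>w. f w * indicator ?E w \<partial>M)"
      if [measurable]: "f \<in> borel_measurable M" and "integrable M f" "\<And>w. 0 \<le> f w" for f
    proof -
      have "P f ?X = (\<integral>\<^sup>+w. ennreal (f w) * indicator ?E w \<partial>M)"
        using X E vimage_history_prod_emb[OF J(2), of A] unfolding P_def
        by (simp add: emeasure_distr emeasure_density del: One_nat_def)
      also have "\<dots> = (\<integral>\<^sup>+w. ennreal (f w * indicator ?E w) \<partial>M)"
        by (intro nn_integral_cong) (simp split: split_indicator)
      also have "\<dots> = ennreal (\<integral>w. f w * indicator ?E w \<partial>M)"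
        using that E by (intro nn_integral_eq_integral integrable_real_mult_indicator) auto
      finally show ?thesis .
    qed
    then show "P f1 ?X = P f2 ?X"
      using integral_offspring_insert[OF g(1) int J i, of v A] f_int f_nonneg
      by (simp add: f1_def f2_def mult.assoc)
  next
    \<comment> \<open>Finiteness allows the passage from cylinders to all measurable sets. It comes
      from integrability of \<open>g\<close>, the indicator being at most 1.\<close>
    have "finite_measure (density M (\<lambda>w. ennreal (f1 w)))"
      using f_int(1) f_nonneg
      by (intro finite_measureI) (simp add: emeasure_density nn_integral_eq_integral cong: nn_integral_cong)
    then show "finite_measure (P f1)"
      unfolding P_def by (rule finite_measure.finite_measure_distr) (simp del: One_nat_def)
  qed (simp_all add: P_def)
  moreover have "(\<integral>\<^sup>+\<omega>. h \<omega> \<partial>P f) = (\<integral>\<^sup>+w. ennreal (f w) * h (history k w) \<partial>M)"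
    if [measurable]: "f \<in> borel_measurable M" for f
    using h unfolding P_def by (simp add: nn_integral_distr nn_integral_density del: One_nat_def)
  ultimately have "(\<integral>\<^sup>+w. ennreal (f1 w) * h (history k w) \<partial>M) = (\<integral>\<^sup>+w. ennreal (f2 w) * h (history k w) \<partial>M)"
    by (metis \<open>f1 \<in> borel_measurable M\<close> \<open>f2 \<in> borel_measurable M\<close>)
  moreover have "ennreal (f1 w) = ennreal (g w) * indicator {v} (N k i w)" for w
    by (simp add: f1_def split: split_indicator)
  ultimately show ?thesis by (simp add: f2_def)
qed

text \<open>The litter size is the sum over v of v times the indicator of {v}, so the preceding
  identity can be summed over v; nonnegativity lets sums and integrals commute. Finiteness of the
  mean identifies the resulting sum with the real series \<open>offspring_mean\<close>.\<close>

lemma nn_integral_mean_history: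
  assumes g: "g \<in> borel_measurable env_algebra" "\<And>w. 0 \<le> g w" and int: "integrable M g"
    and i: "1 \<le> i" and h: "h \<in> borel_measurable (history_space k)"
    and mean_finite: "AE w in M. summable (\<lambda>i. real i * pmf (p (xi k w)) i)"
  shows "(\<integral>\<^sup>+w. ennreal (g w) * of_nat (N k i w) * h (history k w) \<partial>M)
    = (\<integral>\<^sup>+w. ennreal (g w * env_mean k w) * h (history k w) \<partial>M)"
proof -
  note measurable_env_imp[OF g(1), measurable] measurable_env_imp[OF measurable_pmf_xi_env, measurable]
  note measurable_indicator_N[OF i, measurable] h[measurable]
  have "(\<integral>\<^sup>+w. ennreal (g w) * of_nat (N k i w) * h (history k w) \<partial>M)
      = (\<integral>\<^sup>+w. (\<Sum>v. of_nat v * (ennreal (g w) * indicator {v} (N k i w) * h (history k w))) \<partial>M)"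
    by (intro nn_integral_cong) (subst of_nat_eq_suminf_indicator, simp add: mult_ac
        ennreal_suminf_cmult[symmetric] del: ennreal_suminf_cmult)
  also have "\<dots> = (\<Sum>v. of_nat v * (\<integral>\<^sup>+w. ennreal (g w) * indicator {v} (N k i w) * h (history k w) \<partial>M))"
    by (subst nn_integral_suminf) (simp_all add: nn_integral_cmult)
  also have "\<dots> = (\<Sum>v. of_nat v * (\<integral>\<^sup>+w. ennreal (g w * pmf (p (xi k w)) v) * h (history k w) \<partial>M))"
    by (simp only: nn_integral_offspring_history[OF g int i h])
  also have "\<dots> = (\<integral>\<^sup>+w. (\<Sum>v. of_nat v * (ennreal (g w * pmf (p (xi k w)) v) * h (history k w))) \<partial>M)"
    by (subst nn_integral_suminf) (simp_all add: nn_integral_cmult)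
  also have "\<dots> = (\<integral>\<^sup>+w. ennreal (g w * env_mean k w) * h (history k w) \<partial>M)"
  proof (rule nn_integral_cong_AE)
    show "AE w in M. (\<Sum>v. of_nat v * (ennreal (g w * pmf (p (xi k w)) v) * h (history k w)))
        = ennreal (g w * env_mean k w) * h (history k w)"
      using mean_finite
    proof eventually_elim
      case (elim w)
      have "(\<Sum>v. of_nat v * (ennreal (g w * pmf (p (xi k w)) v) * h (history k w)))
          = (\<Sum>v. ennreal (g w) * h (history k w) * ennreal (real v * pmf (p (xi k w)) v))"
        using g(2) by (simp add: ennreal_mult ennreal_of_nat_eq_real_of_nat mult_ac)
      also have "\<dots> = ennreal (g w) * h (history k w) * ennreal (env_mean k w)"
        by (simp only: ennreal_suminf_cmult ennreal_offspring_mean[OF elim])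
      finally show ?case using g(2) by (simp add: ennreal_mult' mult_ac)
    qed
  qed
  finally show ?thesis .
qed

subsection \<open>The normalized population\<close>

text \<open>Truncating \<open>1 / m\<close> where \<open>m < 1\<close>, which happens with probability 0, makes this factor lie
  in \<open>[0, 1]\<close> everywhere.\<close>

definition inv_mean :: "nat \<Rightarrow> 'w \<Rightarrow> real" where
  "inv_mean j w = (if 1 \<le> env_mean j w then 1 / env_mean j w else 0)"

lemma inv_mean_bounds: "0 \<le> inv_mean j w" "inv_mean j w \<le> 1" "inv_mean j w * env_mean j w \<le> 1"
  by (auto simp: inv_mean_def)

lemma measurable_inv_mean [measurable]: "inv_mean j \<in> borel_measurable env_algebra"
  unfolding inv_mean_def by measurable

lemma prod_inv_mean:
  shows prod_inv_mean_measurable: "(\<lambda>w. \<Prod>j = a..<k. inv_mean j w) \<in> borel_measurable env_algebra"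
    and prod_inv_mean_nonneg: "0 \<le> (\<Prod>j = a..<k. inv_mean j w)"
    and prod_inv_mean_integrable: "integrable M (\<lambda>w. \<Prod>j = a..<k. inv_mean j w)"
proof -
  show meas: "(\<lambda>w. \<Prod>j = a..<k. inv_mean j w) \<in> borel_measurable env_algebra"
    by measurable
  show "0 \<le> (\<Prod>j = a..<k. inv_mean j w)"
    by (intro prod_nonneg) (simp add: inv_mean_bounds)
  have "norm (\<Prod>j = a..<k. inv_mean j w) \<le> 1" for w
    by (simp add: abs_prod) (intro prod_le_1, auto simp: inv_mean_bounds)
  then show "integrable M (\<lambda>w. \<Prod>j = a..<k. inv_mean j w)"
    by (intro integrable_const_bound[where B = 1] measurable_env_imp[OF meas]) auto
qed

text \<open>A supermartingale argument by induction on k. Given environment and history, generation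
  a + k + 1 has conditional mean m * Z (a + k), where m is the offspring mean of generation a + k,
  and the new factor \<open>inv_mean\<close> times m is at most 1. The divisor Z a is a function of
  the history and stays fixed.\<close>

lemma nn_integral_normalized_population_le_1:
  assumes mean_finite: "AE w in M. summable (\<lambda>i. real i * pmf (p (xi 0 w)) i)"
  shows "(\<integral>\<^sup>+w. ennreal (real (generation_size N (a + k) w) / real (generation_size N a w)
      * (\<Prod>j = a..<a + k. inv_mean j w)) \<partial>M) \<le> 1"
proof (induction k)
  \<comment> \<open>If Z a = 0, the quotient is 0 by the convention for division, so the induction
    starts with an inequality.\<close>
  case 0
  have "(\<integral>\<^sup>+w. ennreal (real (generation_size N a w) / real (generation_size N a w)) \<partial>M)
      \<le> (\<integral>\<^sup>+w. 1 \<partial>M)"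
    by (intro nn_integral_mono) simp
  then show ?case by (simp add: emeasure_space_1)
next
  case (Suc k)
  let ?Z = "generation_size N"
  define G where "G b w = (\<Prod>j = a..<b. inv_mean j w)" for b w
  note G = prod_inv_mean[where a = a, folded G_def]
  note G_meas = measurable_env_imp[OF G(1), measurable]
  have mean_meas [measurable]: "env_mean j \<in> borel_measurable M" for j
    by (rule measurable_env_imp) measurable
  have G_Suc: "G (Suc (a + k)) w * env_mean (a + k) w \<le> G (a + k) w" for w
    using mult_left_mono[OF inv_mean_bounds(3) G(2)] by (simp add: G_def mult.assoc)
  \<comment> \<open>Up to the factor 1 / Z a, \<open>h i\<close> tells whether individual i + 1 of
    generation a + k exists; the series starts at 0, while individuals are numbered from 1.\<close>
  define h :: "nat \<Rightarrow> (nat \<times> nat \<Rightarrow> nat) \<Rightarrow> ennreal"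
    where "h i \<omega> = ennreal (of_bool (i < past_size (a + k) \<omega>) / real (past_size a \<omega>))" for i \<omega>
  have h_hist: "h i (history (a + k) w) = ennreal (of_bool (i < ?Z (a + k) w) / real (?Z a w))" for i w
    by (simp add: h_def past_size_history)
  have h_meas [measurable]: "h i \<in> borel_measurable (history_space (a + k))" for i
  proof -
    have [measurable]: "past_size a \<in> history_space (a + k) \<rightarrow>\<^sub>M count_space UNIV"
      "past_size (a + k) \<in> history_space (a + k) \<rightarrow>\<^sub>M count_space UNIV"
      by (rule measurable_past_size, simp)+
    show ?thesis unfolding h_def by measurable
  qed
  \<comment> \<open>The random upper limit becomes an indicator inside an infinite series, so each
    litter can be averaged separately, with the existence of its parent read off the
    history.\<close>
  have split: "of_nat (\<Sum>i = 1..z. c i) = (\<Sum>i. of_nat (c (Suc i)) * of_bool (i < z) :: ennreal)"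
    for z :: nat and c :: "nat \<Rightarrow> nat"
  proof -
    have "(\<Sum>i. of_nat (c (Suc i)) * of_bool (i < z) :: ennreal) = (\<Sum>i<z. of_nat (c (Suc i)) * of_bool (i < z))"
      by (rule suminf_finite) auto
    also have "\<dots> = (\<Sum>i<z. of_nat (c (Suc i)))" by (intro sum.cong) auto
    also have "\<dots> = (\<Sum>i = 1..z. of_nat (c i))" by (simp add: sum.atLeast1_atMost_eq)
    finally show ?thesis by simp
  qed
  have "(\<integral>\<^sup>+w. ennreal (real (?Z (a + Suc k) w) / real (?Z a w) * G (a + Suc k) w) \<partial>M)
      = (\<integral>\<^sup>+w. (\<Sum>i. ennreal (G (Suc (a + k)) w) * of_nat (N (a + k) (Suc i) w) * h i (history (a + k) w)) \<partial>M)"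
  proof (rule nn_integral_cong)
    fix w
    have "ennreal (real (?Z (a + Suc k) w) / real (?Z a w) * G (a + Suc k) w)
        = ennreal (G (Suc (a + k)) w) * ennreal (1 / real (?Z a w)) * of_nat (?Z (a + Suc k) w)"
      using G(2) by (simp add: ennreal_of_nat_eq_real_of_nat ennreal_mult[symmetric] mult_ac
          del: generation_size.simps)
    also have "of_nat (?Z (a + Suc k) w)
        = (\<Sum>i. of_nat (N (a + k) (Suc i) w) * of_bool (i < ?Z (a + k) w) :: ennreal)"
      using split[of "\<lambda>i. N (a + k) i w" "?Z (a + k) w"] by simp
    also have "ennreal (G (Suc (a + k)) w) * ennreal (1 / real (?Z a w)) * \<dots>
        = (\<Sum>i. ennreal (G (Suc (a + k)) w) * ennreal (1 / real (?Z a w))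
            * (of_nat (N (a + k) (Suc i) w) * of_bool (i < ?Z (a + k) w)))"
      by (rule ennreal_suminf_cmult[symmetric])
    also have "\<dots> = (\<Sum>i. ennreal (G (Suc (a + k)) w) * of_nat (N (a + k) (Suc i) w) * h i (history (a + k) w))"
      by (intro arg_cong[where f = suminf] ext) (simp add: h_hist mult_ac)
    finally show "ennreal (real (?Z (a + Suc k) w) / real (?Z a w) * G (a + Suc k) w) = \<dots>" .
  qed
  also have "\<dots> = (\<Sum>i. \<integral>\<^sup>+w. ennreal (G (Suc (a + k)) w) * of_nat (N (a + k) (Suc i) w) * h i (history (a + k) w) \<partial>M)"
    by (rule nn_integral_suminf) measurable
  also have "\<dots> = (\<Sum>i. \<integral>\<^sup>+w. ennreal (G (Suc (a + k)) w * env_mean (a + k) w) * h i (history (a + k) w) \<partial>M)"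
    using nn_integral_mean_history[OF G _ h_meas AE_summable_mean[OF mean_finite]] by simp
  \<comment> \<open>The mean of generation a + k is absorbed by its truncated reciprocal, leaving
    the normalization of the induction hypothesis.\<close>
  also have "\<dots> \<le> (\<Sum>i. \<integral>\<^sup>+w. ennreal (G (a + k) w) * h i (history (a + k) w) \<partial>M)"
    using G_Suc by (intro suminf_le nn_integral_mono mult_right_mono ennreal_leI) auto
  also have "\<dots> = (\<integral>\<^sup>+w. (\<Sum>i. ennreal (G (a + k) w) * h i (history (a + k) w)) \<partial>M)"
    by (rule nn_integral_suminf[symmetric]) measurable
  also have "\<dots> = (\<integral>\<^sup>+w. ennreal (real (?Z (a + k) w) / real (?Z a w) * G (a + k) w) \<partial>M)"
  proof (rule nn_integral_cong)
    fix w
    have "(\<Sum>i. ennreal (G (a + k) w) * h i (history (a + k) w))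
        = ennreal (G (a + k) w) * (\<Sum>i. ennreal (1 / real (?Z a w)) * of_bool (i < ?Z (a + k) w))"
      by (subst ennreal_suminf_cmult) (intro arg_cong2[where f = "(*)"] arg_cong[where f = suminf] ext refl, simp add: h_hist)
    \<comment> \<open>With every litter of size 1, the same series counts the individuals of
      generation a + k.\<close>
    also have "(\<Sum>i. ennreal (1 / real (?Z a w)) * of_bool (i < ?Z (a + k) w))
        = ennreal (1 / real (?Z a w)) * of_nat (?Z (a + k) w)"
      using split[of "\<lambda>_. 1" "?Z (a + k) w"] by (simp only: ennreal_suminf_cmult) simp
    finally show "(\<Sum>i. ennreal (G (a + k) w) * h i (history (a + k) w))
        = ennreal (real (?Z (a + k) w) / real (?Z a w) * G (a + k) w)"
      using G(2) by (simp add: ennreal_mult'' ennreal_of_nat_eq_real_of_nat ennreal_mult[symmetric] mult_ac)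
  qed
  also have "\<dots> \<le> 1" using Suc.IH by (simp add: G_def)
  finally show ?case by (simp add: G_def)
qed

text \<open>It suffices to follow the individual numbered 1: its litter in generation k is empty
  with probability equal to the expectation of \<open>pmf (p (xi k w)) 0\<close>, which is 0. A
  nonempty generation contains this individual, so the next generation is nonempty as well.\<close>

lemma AE_population_pos:
  assumes "AE w in M. pmf (p (xi 0 w)) 0 = 0"
  shows "AE w in M. \<forall>k. 0 < generation_size N k w"
proof -
  have "AE w in M. N k 1 w \<noteq> 0" for k
  proof -
    have J: "finite {(k, 1::nat)}" "{(k, 1)} \<subseteq> UNIV \<times> {1::nat..}" by auto
    let ?E = "{w \<in> space M. \<forall>(n, i) \<in> {(k, 1)}. N n i w \<in> {0}}"
    have "(\<integral>w. 1 * indicator ?E w \<partial>M)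
        = (\<integral>w. 1 * (\<Prod>(n, i) \<in> {(k, 1::nat)}. measure_pmf.prob (p (xi n w)) {0}) \<partial>M)"
      by (rule integral_offspring_cylinder[OF _ _ J, of "\<lambda>_. 1" "\<lambda>_. {0}"]) auto
    also have "\<dots> = (\<integral>w. 0 \<partial>M)"
      using AE_no_empty_litter[OF assms, of k] measurable_env_imp[OF measurable_pmf_xi_env]
      by (intro integral_cong_AE) (auto simp: measure_pmf_single)
    finally have "prob ?E = 0"
      using sets_offspring_cylinder[OF J, of "\<lambda>_. {0}"] by simp
    then have "AE w in M. w \<notin> ?E"
      using sets_offspring_cylinder[OF J, of "\<lambda>_. {0}"] by (simp add: prob_eq_0)
    then show ?thesis using AE_space by eventually_elim auto
  qed
  then have "AE w in M. \<forall>k. N k 1 w \<noteq> 0" by (simp add: AE_all_countable)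
  then show ?thesis
  proof eventually_elim
    case (elim w)
    have "0 < generation_size N k w" for k
    proof (induction k)
      case (Suc k)
      then have "N k 1 w \<le> generation_size N (Suc k) w"
        by (auto intro!: member_le_sum[of 1 "{1..generation_size N k w}" "\<lambda>i. N k i w", simplified])
      then show ?case using elim[rule_format, of k] by linarith
    qed simp
    then show ?case by simp
  qed
qed

section \<open>Tail bounds for the environment walk and the population\<close>

lemma
  fixes f :: "'e \<Rightarrow> real"
  assumes [measurable]: "f \<in> borel_measurable S"
  shows integrable_xi_iff: "integrable M (\<lambda>w. f (xi n w)) \<longleftrightarrow> integrable M (\<lambda>w. f (xi 0 w))"
    and integral_xi_eq: "(\<integral>w. f (xi n w) \<partial>M) = (\<integral>w. f (xi 0 w) \<partial>M)"
proof -
  show "integrable M (\<lambda>w. f (xi n w)) \<longleftrightarrow> integrable M (\<lambda>w. f (xi 0 w))"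
    by (simp only: integrable_distr_eq[OF measurable_xi assms, symmetric] environment_ident[of n])
  show "(\<integral>w. f (xi n w) \<partial>M) = (\<integral>w. f (xi 0 w) \<partial>M)"
    by (simp only: integral_distr[OF measurable_xi assms, symmetric] environment_ident[of n])
qed

lemma measurable_env_mean: "env_mean n \<in> borel_measurable M"
  by (rule measurable_env_imp) (rule measurable_env_mean_env)

text \<open>Markov's inequality for a nonnegative variable of mean at most 1; the level exp t
  corresponds to ln W >= t.\<close>

lemma prob_normalized_population_ge:
  fixes t :: real and a k :: nat
  assumes mean_finite: "AE w in M. summable (\<lambda>i. real i * pmf (p (xi 0 w)) i)"
  defines "W \<equiv> \<lambda>w. real (generation_size N (a + k) w) / real (generation_size N a w)
      * (\<Prod>j = a..<a + k. inv_mean j w)"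
  shows "{w \<in> space M. exp t \<le> W w} \<in> events"
    and "prob {w \<in> space M. exp t \<le> W w} \<le> exp (- t)"
proof -
  note measurable_env_imp[OF prod_inv_mean(1), measurable]
  have W_meas [measurable]: "W \<in> borel_measurable M" unfolding W_def by measurable
  show "{w \<in> space M. exp t \<le> W w} \<in> events" by measurable
  have W_nonneg: "0 \<le> W w" for w unfolding W_def by (intro mult_nonneg_nonneg prod_inv_mean(2)) simp
  have le: "(\<integral>\<^sup>+w. ennreal (W w) \<partial>M) \<le> 1"
    unfolding W_def by (rule nn_integral_normalized_population_le_1[OF mean_finite])
  then have int: "integrable M W"
    using W_nonneg by (intro integrableI_nonneg) (auto intro: le_less_trans)
  then have "ennreal (expectation W) \<le> 1"
    using le W_nonneg by (simp add: nn_integral_eq_integral)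
  then have "expectation W \<le> 1" by simp
  have "prob {w \<in> space M. exp t \<le> W w} \<le> expectation W / exp t"
    by (rule integral_Markov_inequality_measure[where A = "{}"]) (use int W_nonneg in auto)
  also have "\<dots> \<le> 1 / exp t" using \<open>expectation W \<le> 1\<close> by (simp add: divide_right_mono)
  finally show "prob {w \<in> space M. exp t \<le> W w} \<le> exp (- t)" by (simp add: exp_minus inverse_eq_divide)
qed

text \<open>Bennett's inequality for n independent steps ln m - mu, of total variance n sigma^2 =
  c^2, at half of the deviation x c.\<close>

lemma prob_environment_walk_ge:
  fixes mu sigma H x :: real and a n :: nat
  defines "X \<equiv> \<lambda>w. ln (env_mean 0 w)"
  assumes int: "integrable M X" and mu: "mu = expectation X"
    and int2: "integrable M (\<lambda>w. (X w - mu)\<^sup>2)" and var: "expectation (\<lambda>w. (X w - mu)\<^sup>2) = sigma\<^sup>2"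
    and bound: "AE w in M. X w \<le> mu + H"
    and pos: "0 < sigma" "0 < H" "0 < x" "0 < n"
  defines "c \<equiv> sigma * sqrt (real n)"
  shows "prob {w \<in> space M. x * c / 2 \<le> (\<Sum>j = a..<a + n. ln (env_mean j w) - mu)}
    \<le> exp (- (x * c / (2 * H) * ((1 + 2 * c / (H * x)) * ln (1 + H * x / (2 * c)) - 1)))"
proof -
  \<comment> \<open>The centred step is a function of the environment value alone, so independence
    is inherited from \<open>xi\<close>, and moments and the upper bound transfer from generation
    0.\<close>
  define f where "f e = ln (offspring_mean (p e)) - mu" for e
  note measurable_offspring_mean[of p S, OF offspring_law_measurable, measurable]
  have f_meas [measurable]: "f \<in> borel_measurable S" unfolding f_def by measurable
  have c: "0 < c" "c\<^sup>2 = real n * sigma\<^sup>2" using pos by (simp_all add: c_def power_mult_distrib)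
  have f0: "integrable M (\<lambda>w. f (xi 0 w))" "expectation (\<lambda>w. f (xi 0 w)) = 0"
    "integrable M (\<lambda>w. (f (xi 0 w))\<^sup>2)" "expectation (\<lambda>w. (f (xi 0 w))\<^sup>2) = sigma\<^sup>2"
    using int int2 mu var by (simp_all add: f_def X_def prob_space)
  have "prob {w \<in> space M. x * c / 2 \<le> (\<Sum>j = a..<a + n. f (xi j w))}
      \<le> exp (- (c\<^sup>2 / H\<^sup>2 * ((1 + H * (x * c / 2) / c\<^sup>2) * ln (1 + H * (x * c / 2) / c\<^sup>2)
        - H * (x * c / 2) / c\<^sup>2)))"
  proof (rule bennett_inequality)
    show "indep_vars (\<lambda>_. borel) (\<lambda>j w. f (xi j w)) {a..<a + n}"
      by (rule indep_vars_compose2[OF indep_vars_subset[OF environment_indep]]) auto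
    fix j
    show "integrable M (\<lambda>w. f (xi j w))" using f0(1) integrable_xi_iff[OF f_meas, of j] by simp
    show "integrable M (\<lambda>w. (f (xi j w))\<^sup>2)"
      using f0(3) integrable_xi_iff[of "\<lambda>e. (f e)\<^sup>2" j] by simp
    show "expectation (\<lambda>w. f (xi j w)) = 0" using f0(2) integral_xi_eq[OF f_meas, of j] by simp
    show "AE w in M. f (xi j w) \<le> H"
    proof (rule AE_xi)
      show "{e \<in> space S. f e \<le> H} \<in> sets S" by measurable
      show "AE w in M. f (xi 0 w) \<le> H" using bound by (simp add: f_def X_def algebra_simps)
    qed
  next
    have "expectation (\<lambda>w. (f (xi j w))\<^sup>2) = sigma\<^sup>2" for j
      using f0(4) integral_xi_eq[of "\<lambda>e. (f e)\<^sup>2" j] by simp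
    then show "c\<^sup>2 = (\<Sum>j = a..<a + n. expectation (\<lambda>w. (f (xi j w))\<^sup>2))"
      by (simp add: c)
  qed (use pos c(1) in simp_all)
  then show ?thesis
    unfolding bennett_rate_eq[OF c(1) pos(2,3)] by (simp add: f_def)
qed

lemma prob_log_population_ge:
  fixes mu sigma H x :: real and a n :: nat
  defines "X \<equiv> \<lambda>w. ln (env_mean 0 w)" and "Z \<equiv> generation_size N"
  assumes mean_finite: "AE w in M. summable (\<lambda>i. real i * pmf (p (xi 0 w)) i)"
    and no_extinction: "AE w in M. pmf (p (xi 0 w)) 0 = 0"
    and int: "integrable M X" and mu: "mu = expectation X"
    and int2: "integrable M (\<lambda>w. (X w - mu)\<^sup>2)" and var: "expectation (\<lambda>w. (X w - mu)\<^sup>2) = sigma\<^sup>2"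
    and bound: "AE w in M. X w \<le> mu + H"
    and pos: "0 < sigma" "0 < H" "0 < x" "0 < n"
  defines "c \<equiv> sigma * sqrt (real n)"
  shows "prob {w \<in> space M. x \<le> (ln (real (Z (a + n) w) / real (Z a w)) - real n * mu) / c}
    \<le> exp (- (x * c / (2 * H) * ((1 + 2 * c / (H * x)) * ln (1 + H * x / (2 * c)) - 1)))
      + exp (- (x * c / 2))"
proof -
  define W where "W w = real (Z (a + n) w) / real (Z a w) * (\<Prod>j = a..<a + n. inv_mean j w)" for w
  define A where "A = {w \<in> space M. x * c / 2 \<le> (\<Sum>j = a..<a + n. ln (env_mean j w) - mu)}"
  define B where "B = {w \<in> space M. exp (x * c / 2) \<le> W w}"
  have c: "0 < c" using pos by (simp add: c_def)
  note measurable_env_mean [measurable]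
  have A: "A \<in> events" unfolding A_def by measurable
  have B: "B \<in> events" "prob B \<le> exp (- (x * c / 2))"
    using prob_normalized_population_ge[OF mean_finite, of "x * c / 2" a n]
    by (simp_all add: B_def W_def Z_def)
  \<comment> \<open>Means at least 1 make the truncation in \<open>inv_mean\<close> inactive, and
    positive generation sizes let the logarithm of the product split. Both hold almost surely, which
    is the sense in which the tail event lies in the union of \<open>A\<close> and
    \<open>B\<close>.\<close>
  have "AE w in M. 1 \<le> env_mean j w" for j
    using AE_summable_mean[OF mean_finite] AE_no_empty_litter[OF no_extinction]
    by eventually_elim (rule offspring_mean_ge_1)
  then have "AE w in M. \<forall>j. 1 \<le> env_mean j w" by (simp add: AE_all_countable)
  moreover have "AE w in M. \<forall>k. 0 < Z k w"
    unfolding Z_def by (rule AE_population_pos[OF no_extinction])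
  ultimately have "AE w in M. w \<in> {w \<in> space M. x \<le> (ln (real (Z (a + n) w) / real (Z a w)) - real n * mu) / c}
      \<longrightarrow> w \<in> A \<union> B"
  proof eventually_elim
    case (elim w)
    have m: "0 < env_mean j w" "env_mean j w \<noteq> 0" "inv_mean j w = 1 / env_mean j w" for j
      using elim(1)[rule_format, of j] by (auto simp: inv_mean_def)
    have q: "0 < real (Z (a + n) w) / real (Z a w)" using elim(2) by simp
    have r: "0 < (\<Prod>j = a..<a + n. inv_mean j w)" using m by (intro prod_pos) simp
    have W_pos: "0 < W w" unfolding W_def using q r by (rule mult_pos_pos)
    have "ln (\<Prod>j = a..<a + n. inv_mean j w) = (\<Sum>j = a..<a + n. ln (inv_mean j w))"
      using m by (intro ln_prod) auto
    also have "\<dots> = - (\<Sum>j = a..<a + n. ln (env_mean j w))"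
      using m by (simp add: ln_div sum_negf)
    finally have "ln (real (Z (a + n) w) / real (Z a w))
        = ln (W w) + (\<Sum>j = a..<a + n. ln (env_mean j w))"
      unfolding W_def ln_mult_pos[OF q r] by simp
    then have dec: "ln (real (Z (a + n) w) / real (Z a w)) - real n * mu
        = ln (W w) + (\<Sum>j = a..<a + n. ln (env_mean j w) - mu)"
      by (simp add: sum_subtractf)
    show ?case
    proof
      assume "w \<in> {w \<in> space M. x \<le> (ln (real (Z (a + n) w) / real (Z a w)) - real n * mu) / c}"
      then have w: "w \<in> space M" and "x * c \<le> ln (W w) + (\<Sum>j = a..<a + n. ln (env_mean j w) - mu)"
        using c by (auto simp: dec pos_le_divide_eq)
      \<comment> \<open>Two numbers with sum at least x c cannot both lie below x c / 2.\<close>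
      then have "x * c / 2 \<le> (\<Sum>j = a..<a + n. ln (env_mean j w) - mu) \<or> x * c / 2 \<le> ln (W w)"
        by linarith
      then show "w \<in> A \<union> B"
        using w unfolding A_def B_def ln_ge_iff[OF W_pos] by blast
    qed
  qed
  then have "prob {w \<in> space M. x \<le> (ln (real (Z (a + n) w) / real (Z a w)) - real n * mu) / c}
      \<le> prob (A \<union> B)"
    using A B by (intro finite_measure_mono_AE) auto
  also have "\<dots> \<le> prob A + prob B" using A B(1) by (rule measure_Un_le)
  also have "\<dots> \<le> exp (- (x * c / (2 * H) * ((1 + 2 * c / (H * x)) * ln (1 + H * x / (2 * c)) - 1)))
      + exp (- (x * c / 2))"
    unfolding A_def c_def
    using prob_environment_walk_ge[OF int[unfolded X_def] mu[unfolded X_def] int2[unfolded X_def]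
        var[unfolded X_def] bound[unfolded X_def] pos] B(2)
    by (intro add_mono) (simp_all add: c_def)
  finally show ?thesis .
qed

end

text \<open>With c = sigma * sqrt n and u = H x / (2 c), the prefactor of the bracket is x c / (2 H)
  = c^2 / H^2 * u, so for small u the exponent is close to x^2 / 8, in accordance with the second
  bounds. A prefactor x / (2 H) would yield an exponent of at most x^2 / (8 c), too small for these
  bounds when c is large. Summability of the mean gives \<open>offspring_mean\<close> its intended
  value.\<close>

theorem theorem2p5:
  fixes M :: "'w measure" and S :: "'e measure" and p :: "'e \<Rightarrow> nat pmf"
    and xi :: "nat \<Rightarrow> 'w \<Rightarrow> 'e" and N :: "nat \<Rightarrow> nat \<Rightarrow> 'w \<Rightarrow> nat"
    and X :: "'w \<Rightarrow> real" and Z :: "nat \<Rightarrow> 'w \<Rightarrow> nat" and Zn :: "'w \<Rightarrow> real"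
    and mu sigma H :: real and n0 n :: nat
  assumes bpre: "branching_process_iid_environment M S p xi N"
    and Z: "Z = generation_size N"
    and mean_finite: "AE w in M. summable (\<lambda>i. real i * pmf (p (xi 0 w)) i)"
    and no_extinction: "AE w in M. pmf (p (xi 0 w)) 0 = 0"
    and X: "X = (\<lambda>w. ln (offspring_mean (p (xi 0 w))))"
    and X_integrable: "integrable M X"
    and mu: "mu = (\<integral>w. X w \<partial>M)"
    and variance_finite: "integrable M (\<lambda>w. (X w - mu)\<^sup>2)"
    and sigma: "sigma = sqrt (\<integral>w. (X w - mu)\<^sup>2 \<partial>M)"
    and sigma_pos: "0 < sigma"
    and H_pos: "0 < H"
    and X_bounded: "AE w in M. X w \<le> mu + H"
    and n_pos: "1 \<le> n"
    and Zn: "Zn = (\<lambda>w. (ln (real (Z (n0 + n) w) / real (Z n0 w)) - real n * mu)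
                      / (sigma * sqrt (real n)))"
  shows
    "(\<forall>x::real. 0 < x \<and> x \<le> sigma * sqrt (real n) / 2 \<longrightarrow>
        measure M {w \<in> space M. Zn w \<ge> x}
          \<le> 2 * exp (- (x * sigma * sqrt (real n) / (2 * H)
                * ((1 + 2 * sigma * sqrt (real n) / (H * x))
                     * ln (1 + H * x / (2 * sigma * sqrt (real n))) - 1)))
        \<and> 2 * exp (- (x * sigma * sqrt (real n) / (2 * H)
                * ((1 + 2 * sigma * sqrt (real n) / (H * x))
                     * ln (1 + H * x / (2 * sigma * sqrt (real n))) - 1)))
          \<le> 2 * exp (- (x\<^sup>2 / (8 * (1 + H * x / (6 * sigma * sqrt (real n)))))))
     \<and> (\<forall>x::real. x > sigma * sqrt (real n) / 2 \<longrightarrow>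
        measure M {w \<in> space M. Zn w \<ge> x}
          \<le> exp (- (x * sigma * sqrt (real n) / (2 * H)
                * ((1 + 2 * sigma * sqrt (real n) / (H * x))
                     * ln (1 + H * x / (2 * sigma * sqrt (real n))) - 1)))
            + exp (- (x * sigma * sqrt (real n) / 2))
        \<and> exp (- (x * sigma * sqrt (real n) / (2 * H)
                * ((1 + 2 * sigma * sqrt (real n) / (H * x))
                     * ln (1 + H * x / (2 * sigma * sqrt (real n))) - 1)))
            + exp (- (x * sigma * sqrt (real n) / 2))
          \<le> exp (- (x\<^sup>2 / (8 * (1 + H * x / (6 * sigma * sqrt (real n))))))
            + exp (- (x * sigma * sqrt (real n) / 2)))"
proof -
  interpret branching_process_iid_environment M S p xi N by (rule bpre)
  define c where "c = sigma * sqrt (real n)"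
  have c: "0 < c" using sigma_pos n_pos by (simp add: c_def)
  define R where "R x = x * c / (2 * H) * ((1 + 2 * c / (H * x)) * ln (1 + H * x / (2 * c)) - 1)" for x
  have var: "expectation (\<lambda>w. (X w - mu)\<^sup>2) = sigma\<^sup>2"
    by (simp add: sigma integral_nonneg_AE)
  have tail: "prob {w \<in> space M. x \<le> Zn w} \<le> exp (- R x) + exp (- (x * c / 2))" if "0 < x" for x
    using prob_log_population_ge[OF mean_finite no_extinction X_integrable[unfolded X] mu[unfolded X]
        variance_finite[unfolded X] var[unfolded X] X_bounded[unfolded X] sigma_pos H_pos that, of n n0] n_pos
    by (simp add: Zn Z R_def c_def)
  have lower: "x\<^sup>2 / (8 * (1 + H * x / (6 * c))) \<le> R x" if "0 < x" for x
    unfolding R_def by (rule bennett_rate_ge[OF c H_pos that])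
  have upper: "R x \<le> x * c / 2" if "0 < x" "x \<le> c / 2" for x
  proof -
    have "R x \<le> x\<^sup>2 / 8" unfolding R_def by (rule bennett_rate_le[OF c H_pos that(1)])
    \<comment> \<open>This amounts to x <= 4 c, which follows from x <= c / 2. It makes the Markov
      term at most the Bennett term, whence the factor 2.\<close>
    also have "\<dots> \<le> x * c / 2"
      using mult_left_mono[of x "4 * c" x] that c by (simp add: power2_eq_square)
    finally show ?thesis .
  qed
  have small: "prob {w \<in> space M. x \<le> Zn w} \<le> 2 * exp (- R x)
      \<and> 2 * exp (- R x) \<le> 2 * exp (- (x\<^sup>2 / (8 * (1 + H * x / (6 * c)))))"
    if "0 < x" "x \<le> c / 2" for x
  proof -
    have "exp (- (x * c / 2)) \<le> exp (- R x)" using upper[OF that] by simp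
    moreover have "exp (- R x) \<le> exp (- (x\<^sup>2 / (8 * (1 + H * x / (6 * c)))))"
      using lower[OF that(1)] by simp
    ultimately show ?thesis using tail[OF that(1)] by (intro conjI) linarith+
  qed
  have large: "prob {w \<in> space M. x \<le> Zn w} \<le> exp (- R x) + exp (- (x * c / 2))
      \<and> exp (- R x) + exp (- (x * c / 2))
        \<le> exp (- (x\<^sup>2 / (8 * (1 + H * x / (6 * c))))) + exp (- (x * c / 2))"
    if "c / 2 < x" for x
    using tail[of x] lower[of x] that c by auto
  \<comment> \<open>Unfolding \<open>c\<close> produces products such as x * (sigma * sqrt n);
    reassociation matches them with those of the statement.\<close>
  show ?thesis
    using small large unfolding R_def c_def by (simp only: mult.assoc) blast
qed

end
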